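(* Let $I\subset\mathbb{R}$ be an interval and let $p\in\mathbb{N}$ with $p>1$. If $\mathbf{M}\colon I^p\to I^p$ is a continuous, weakly contractive mean-type mapping, then there exists a unique $\mathbf{M}$-invariant mean $K\colon I^p\to I$. Moreover, the sequence of iterates $(\mathbf{M}^n)_{n\in\mathbb{N}}$ converges pointwise on $I^p$ to $\mathbf{K}:=(K,\dots,K)$.
   Context: For $v=(v_1,\dots,v_p)\in I^p$ write $\min(v)=\min(v_1,\dots,v_p)$ and $\max(v)=\max(v_1,\dots,v_p)$. A function $M\colon I^p\to I$ is called a mean (in $I$) if $\min(v)\le M(v)\le\max(v)$ for all $v\in I^p$; means are not assumed continuous. A mapping $\mathbf{M}\colon I^p\to I^p$ is called mean-type if $\mathbf{M}=(M_1,\dots,M_p)$ for some means $M_1,\dots,M_p\colon I^p\to I$. A function $K\colon I^p\to\mathbb{R}$ is $\mathbf{M}$-invariant if $K\circ\mathbf{M}=K$. $\mathbf{M}^n$ denotes the $n$-th iterate of $\mathbf{M}$ under composition. A mean-type mapping $\mathbf{M}\colon I^p\to I^p$ is weakly contractive if for every nonconstant vector $v\in I^p$ (i.e. a vector whose coordinates are not all equal) there is a positive integer $n_0(v)$ such that $\max(\mathbf{M}^n(v))-\min(\mathbf{M}^n(v))<\max(v)-\min(v)$ for all $n\ge n_0(v)$. *)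

theory Defs
  imports "HOL-Analysis.Analysis" "HOL-Library.FuncSet"
begin

definition cube :: "real set \<Rightarrow> (real ^ 'p) set" where
  "cube I = {v. \<forall>i. v $ i \<in> I}"

definition vmin :: "real ^ 'p::finite \<Rightarrow> real" where
  "vmin v = Min (range (\<lambda>i. v $ i))"

definition vmax :: "real ^ 'p::finite \<Rightarrow> real" where
  "vmax v = Max (range (\<lambda>i. v $ i))"

text \<open>Maps with domain \<open>cube I\<close> are total functions; the predicates below
  concern their values on \<open>cube I\<close> only (a mean-type map sends \<open>cube I\<close> into itself, so this
  also holds for its iterates).\<close>

definition is_mean :: "real set \<Rightarrow> (real ^ 'p::finite \<Rightarrow> real) \<Rightarrow> bool" where
  "is_mean I K \<longleftrightarrow>
     K \<in> cube I \<rightarrow> I \<and> (\<forall>v\<in>cube I. vmin v \<le> K v \<and> K v \<le> vmax v)"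

definition mean_type :: "real set \<Rightarrow> (real ^ 'p::finite \<Rightarrow> real ^ 'p) \<Rightarrow> bool" where
  "mean_type I M \<longleftrightarrow> (\<forall>i. is_mean I (\<lambda>v. M v $ i))"

definition invariant_on ::
  "real set \<Rightarrow> (real ^ 'p::finite \<Rightarrow> real ^ 'p) \<Rightarrow> (real ^ 'p \<Rightarrow> real) \<Rightarrow> bool" where
  "invariant_on I M K \<longleftrightarrow> (\<forall>v\<in>cube I. (K \<circ> M) v = K v)"

definition weakly_contractive ::
  "real set \<Rightarrow> (real ^ 'p::finite \<Rightarrow> real ^ 'p) \<Rightarrow> bool" where
  "weakly_contractive I M \<longleftrightarrow>
     (\<forall>v\<in>cube I. (\<exists>i j. v $ i \<noteq> v $ j) \<longrightarrow>
        (\<exists>n0>0. \<forall>n\<ge>n0. vmax ((M ^^ n) v) - vmin ((M ^^ n) v) < vmax v - vmin v))"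

end

theory Submission
  imports Defs
begin

text \<open>
  Along an orbit of a mean-type map the minimal coordinate is nondecreasing and the maximal one is
  nonincreasing, so they converge to some \<open>a \<le> b\<close>. Everything rests on the fact that weak
  contractivity forces \<open>a = b\<close> (lemma \<open>oscillation_tendsto_zero\<close>). The orbit of \<open>v\<close> stays in the
  compact cube \<open>[min v, max v]\<^sup>p\<close>, hence has a cluster point \<open>w\<close>. Every \<open>M\<^sup>n w\<close> is again a cluster
  point of the orbit, because \<open>M\<^sup>n\<close> is continuous, and at a cluster point the continuous functions
  \<open>min\<close> and \<open>max\<close> take their limit values \<open>a\<close> and \<open>b\<close>. So the oscillation \<open>max - min\<close> is constant,
  equal to \<open>b - a\<close>, along the whole orbit of \<open>w\<close>; weak contractivity permits this only if \<open>w\<close> is a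
  constant vector, which means \<open>a = b\<close>.

  Consequently \<open>M\<^sup>n v\<close> converges to a constant vector, and the common value of its coordinates,
  as a function of \<open>v\<close>, is a mean that does not change when \<open>v\<close> is replaced by \<open>M v\<close>. Conversely,
  an invariant mean \<open>K\<close> satisfies \<open>K v = K (M\<^sup>n v)\<close>, which lies between \<open>min (M\<^sup>n v)\<close> and
  \<open>max (M\<^sup>n v)\<close>; letting \<open>n\<close> grow identifies \<open>K v\<close> with that limit.
\<close>

section \<open>Minimal and maximal coordinates\<close>

lemma vmin_le: "vmin v \<le> v $ i"
  unfolding vmin_def by (rule Min_le) auto

lemma le_vmax: "v $ i \<le> vmax v"
  unfolding vmax_def by (rule Max_ge) auto

lemma vmin_le_vmax: "vmin v \<le> vmax v"
  using vmin_le le_vmax by (rule order_trans)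

lemma vmin_attained: "\<exists>i. vmin v = v $ i"
proof -
  have "vmin v \<in> range (\<lambda>i. v $ i)"
    unfolding vmin_def by (rule Min_in) auto
  then show ?thesis by auto
qed

lemma vmax_attained: "\<exists>i. vmax v = v $ i"
proof -
  have "vmax v \<in> range (\<lambda>i. v $ i)"
    unfolding vmax_def by (rule Max_in) auto
  then show ?thesis by auto
qed

lemma vmin_in: "v \<in> cube I \<Longrightarrow> vmin v \<in> I"
  using vmin_attained[of v] by (auto simp: cube_def)

lemma vmax_in: "v \<in> cube I \<Longrightarrow> vmax v \<in> I"
  using vmax_attained[of v] by (auto simp: cube_def)

lemma vmax_eq_vmin_uminus: "vmax v = - vmin (- v)"
proof (rule antisym)
  obtain i where "vmax v = v $ i" using vmax_attained by blast
  then show "vmax v \<le> - vmin (- v)" using vmin_le[of "- v" i] by simp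
  obtain j where "vmin (- v) = (- v) $ j" using vmin_attained by blast
  then show "- vmin (- v) \<le> vmax v" using le_vmax[of v j] by simp
qed

lemma vmin_le_vmin_plus_dist: "vmin v \<le> vmin w + dist v w"
proof -
  obtain i where "vmin w = w $ i" using vmin_attained by blast
  moreover have "v $ i - w $ i \<le> dist v w"
    using component_le_norm_cart[of "v - w" i] by (simp add: dist_norm)
  ultimately show ?thesis using vmin_le[of v i] by linarith
qed

lemma continuous_on_vmin: "continuous_on UNIV (vmin :: real ^ 'p::finite \<Rightarrow> real)"
proof -
  have "1-lipschitz_on UNIV (vmin :: real ^ 'p \<Rightarrow> real)"
  proof (rule lipschitz_onI)
    fix v w :: "real ^ 'p"
    show "dist (vmin v) (vmin w) \<le> 1 * dist v w"
      using vmin_le_vmin_plus_dist[of v w] vmin_le_vmin_plus_dist[of w v]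
      by (simp add: dist_real_def dist_commute abs_le_iff)
  qed simp
  then show ?thesis by (rule lipschitz_on_continuous_on)
qed

lemma tendsto_vmin: "(f \<longlongrightarrow> l) F \<Longrightarrow> ((\<lambda>x. vmin (f x)) \<longlongrightarrow> vmin l) F"
  using continuous_on_vmin by (rule continuous_on_tendsto_compose) auto

lemma tendsto_vmax: "(f \<longlongrightarrow> l) F \<Longrightarrow> ((\<lambda>x. vmax (f x)) \<longlongrightarrow> vmax l) F"
  unfolding vmax_eq_vmin_uminus by (intro tendsto_minus tendsto_vmin)

section \<open>Orbits of mean-type maps\<close>

lemma mean_type_cube: "mean_type I M \<Longrightarrow> v \<in> cube I \<Longrightarrow> M v \<in> cube I"
  by (auto simp: mean_type_def is_mean_def cube_def)

lemma mean_type_iterate_cube: "mean_type I M \<Longrightarrow> v \<in> cube I \<Longrightarrow> (M ^^ n) v \<in> cube I"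
  by (induction n) (auto intro: mean_type_cube)

lemma mean_type_vmin_le: "mean_type I M \<Longrightarrow> v \<in> cube I \<Longrightarrow> vmin v \<le> vmin (M v)"
  using vmin_attained[of "M v"] by (auto simp: mean_type_def is_mean_def)

lemma mean_type_vmax_le: "mean_type I M \<Longrightarrow> v \<in> cube I \<Longrightarrow> vmax (M v) \<le> vmax v"
  using vmax_attained[of "M v"] by (auto simp: mean_type_def is_mean_def)

lemma incseq_vmin_orbit:
  assumes "mean_type I M" "v \<in> cube I"
  shows "incseq (\<lambda>n. vmin ((M ^^ n) v))"
  using mean_type_vmin_le[OF assms(1) mean_type_iterate_cube[OF assms]]
  by (intro incseq_SucI) simp

lemma decseq_vmax_orbit:
  assumes "mean_type I M" "v \<in> cube I"
  shows "decseq (\<lambda>n. vmax ((M ^^ n) v))"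
  using mean_type_vmax_le[OF assms(1) mean_type_iterate_cube[OF assms]]
  by (intro decseq_SucI) simp

lemma vmin_le_vmin_orbit:
  assumes "mean_type I M" "v \<in> cube I"
  shows "vmin v \<le> vmin ((M ^^ n) v)"
  using incseqD[OF incseq_vmin_orbit[OF assms], of 0 n] by simp

lemma vmax_orbit_le_vmax:
  assumes "mean_type I M" "v \<in> cube I"
  shows "vmax ((M ^^ n) v) \<le> vmax v"
  using decseqD[OF decseq_vmax_orbit[OF assms], of 0 n] by simp

lemma vmin_orbit_converges:
  assumes "mean_type I M" "v \<in> cube I"
  obtains a where "(\<lambda>n. vmin ((M ^^ n) v)) \<longlonglongrightarrow> a"
proof -
  have "vmin ((M ^^ n) v) \<le> vmax v" for n
    using vmin_le_vmax vmax_orbit_le_vmax[OF assms] by (rule order_trans)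
  then show ?thesis
    using incseq_convergent[OF incseq_vmin_orbit[OF assms]] that by blast
qed

lemma vmax_orbit_converges:
  assumes "mean_type I M" "v \<in> cube I"
  obtains b where "(\<lambda>n. vmax ((M ^^ n) v)) \<longlonglongrightarrow> b"
proof -
  have "vmin v \<le> vmax ((M ^^ n) v)" for n
    using vmin_le_vmin_orbit[OF assms] vmin_le_vmax by (rule order_trans)
  then show ?thesis
    using decseq_convergent[OF decseq_vmax_orbit[OF assms]] that by blast
qed

lemma continuous_on_iterate:
  fixes f :: "'a::topological_space \<Rightarrow> 'a"
  assumes "continuous_on S f" "f \<in> S \<rightarrow> S"
  shows "continuous_on S (f ^^ n)"
proof (induction n)
  case 0
  show ?case by (simp add: continuous_on_id')
next
  case (Suc n)
  have "(f ^^ n) ` S \<subseteq> S"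
    using assms(2) by (induction n) auto
  then show ?case
    using continuous_on_compose[OF Suc.IH continuous_on_subset[OF assms(1)]] by simp
qed

text \<open>The interval \<open>I\<close> need not be closed, so a cluster point could a priori fall outside \<open>I\<^sup>p\<close>;
  this is excluded because the orbit never leaves the compact cube spanned by the extreme
  coordinates of its starting point, both of which belong to \<open>I\<close>.\<close>

lemma orbit_has_cluster_point:
  fixes M :: "real ^ 'p::finite \<Rightarrow> real ^ 'p"
  assumes "is_interval I" "mean_type I M" "v \<in> cube I"
  obtains w r where "w \<in> cube I" "strict_mono r" "(\<lambda>k. (M ^^ r k) v) \<longlonglongrightarrow> w"
proof -
  define B :: "(real ^ 'p) set" where "B = cbox (\<chi> i. vmin v) (\<chi> i. vmax v)"
  have "(M ^^ n) v \<in> B" for n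
    using order_trans[OF vmin_le_vmin_orbit[OF assms(2,3)] vmin_le]
      order_trans[OF le_vmax vmax_orbit_le_vmax[OF assms(2,3)]]
    by (simp add: B_def mem_box_cart)
  moreover have "seq_compact B"
    unfolding B_def by (intro compact_imp_seq_compact compact_cbox)
  ultimately obtain w r where w: "w \<in> B" "strict_mono r" "(\<lambda>k. (M ^^ r k) v) \<longlonglongrightarrow> w"
    using seq_compactE[of B "\<lambda>n. (M ^^ n) v"] unfolding o_def by metis
  have "w $ i \<in> I" for i
    using w(1) vmin_in[OF assms(3)] vmax_in[OF assms(3)]
    by (auto simp: B_def mem_box_cart intro: mem_is_interval_1_I[OF assms(1)])
  then have "w \<in> cube I" by (simp add: cube_def)
  then show ?thesis using that w(2,3) by blast
qed

section \<open>Weak contractivity makes orbits converge\<close>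

text \<open>Were the limit \<open>b - a\<close> of the oscillation positive, the orbit of a cluster point would be
  nonconstant with oscillation \<open>b - a\<close> at all times.\<close>

lemma oscillation_tendsto_zero:
  fixes M :: "real ^ 'p::finite \<Rightarrow> real ^ 'p"
  assumes "is_interval I" "continuous_on (cube I) M" "mean_type I M" "weakly_contractive I M"
    and v: "v \<in> cube I"
  shows "(\<lambda>n. vmax ((M ^^ n) v) - vmin ((M ^^ n) v)) \<longlonglongrightarrow> 0"
proof -
  obtain a where a: "(\<lambda>n. vmin ((M ^^ n) v)) \<longlonglongrightarrow> a"
    using vmin_orbit_converges[OF assms(3) v] .
  obtain b where b: "(\<lambda>n. vmax ((M ^^ n) v)) \<longlonglongrightarrow> b"
    using vmax_orbit_converges[OF assms(3) v] .
  obtain w r where w: "w \<in> cube I" and r: "strict_mono r" and "(\<lambda>k. (M ^^ r k) v) \<longlonglongrightarrow> w"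
    using orbit_has_cluster_point[OF assms(1,3) v] .
  have cont: "continuous_on (cube I) (M ^^ n)" for n
    using assms(2) mean_type_cube[OF assms(3)] by (intro continuous_on_iterate) auto
  have shifted: "(\<lambda>k. (M ^^ (n + r k)) v) \<longlonglongrightarrow> (M ^^ n) w" for n
    using continuous_on_tendsto_compose[OF cont \<open>(\<lambda>k. (M ^^ r k) v) \<longlonglongrightarrow> w\<close> w, of n]
      mean_type_iterate_cube[OF assms(3) v] by (simp add: funpow_add)
  have sub: "filterlim (\<lambda>k. n + r k) at_top sequentially" for n
    using r by (intro filterlim_subseq) (simp add: strict_mono_def)
  have vmin_w: "vmin ((M ^^ n) w) = a" for n
    using LIMSEQ_unique[OF tendsto_vmin[OF shifted] filterlim_compose[OF a sub]] .
  have vmax_w: "vmax ((M ^^ n) w) = b" for n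
    using LIMSEQ_unique[OF tendsto_vmax[OF shifted] filterlim_compose[OF b sub]] .
  have "\<not> (\<exists>i j. w $ i \<noteq> w $ j)"
  proof
    assume "\<exists>i j. w $ i \<noteq> w $ j"
    then obtain n0 where "\<forall>n\<ge>n0. vmax ((M ^^ n) w) - vmin ((M ^^ n) w) < vmax w - vmin w"
      using assms(4) w unfolding weakly_contractive_def by blast
    then show False using vmin_w vmax_w vmin_w[of 0] vmax_w[of 0] by auto
  qed
  then have "vmin w = vmax w"
    using vmin_attained[of w] vmax_attained[of w] by metis
  then have "a = b" using vmin_w[of 0] vmax_w[of 0] by simp
  then show ?thesis using tendsto_diff[OF b a] by simp
qed

lemma invariant_mean_iterate:
  assumes "mean_type I M" "invariant_on I M K" "v \<in> cube I"
  shows "K ((M ^^ n) v) = K v"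
proof (induction n)
  case (Suc n)
  then show ?case
    using assms(2) mean_type_iterate_cube[OF assms(1,3), of n] by (simp add: invariant_on_def)
qed simp

text \<open>The minimal coordinate stands here for the common limit of all coordinates, so this
  determines \<open>K\<close> by \<open>M\<close> alone.\<close>

lemma vmin_orbit_tendsto_invariant_mean:
  assumes "mean_type I M" "v \<in> cube I" "is_mean I K" "invariant_on I M K"
    and osc: "(\<lambda>n. vmax ((M ^^ n) v) - vmin ((M ^^ n) v)) \<longlonglongrightarrow> 0"
  shows "(\<lambda>n. vmin ((M ^^ n) v)) \<longlonglongrightarrow> K v"
proof -
  have "vmin ((M ^^ n) v) \<le> K v \<and> K v \<le> vmax ((M ^^ n) v)" for n
    using assms(3) mean_type_iterate_cube[OF assms(1,2), of n]
    unfolding is_mean_def invariant_mean_iterate[OF assms(1,4,2), of n, symmetric] by blast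
  then have "norm (vmin ((M ^^ n) v) - K v) \<le> vmax ((M ^^ n) v) - vmin ((M ^^ n) v)" for n
    by (simp add: abs_le_iff)
  then have "(\<lambda>n. vmin ((M ^^ n) v) - K v) \<longlonglongrightarrow> 0"
    by (intro Lim_null_comparison[OF _ osc]) simp
  then show ?thesis by (rule LIM_zero_cancel)
qed

lemma tendsto_constant_vector:
  fixes f :: "'a \<Rightarrow> real ^ 'p::finite"
  assumes "((\<lambda>x. vmin (f x)) \<longlongrightarrow> c) F" "((\<lambda>x. vmax (f x) - vmin (f x)) \<longlongrightarrow> 0) F"
  shows "(f \<longlongrightarrow> (\<chi> i. c)) F"
proof (rule vec_tendstoI)
  fix i
  have "((\<lambda>x. vmax (f x)) \<longlongrightarrow> c) F"
    using tendsto_add[OF assms] by simp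
  then have "((\<lambda>x. f x $ i) \<longlongrightarrow> c) F"
    by (rule tendsto_sandwich[OF _ _ assms(1), rotated 2]) (simp_all add: vmin_le le_vmax)
  then show "((\<lambda>x. f x $ i) \<longlongrightarrow> (\<chi> i. c) $ i) F" by simp
qed

text \<open>The limit along the orbit is invariant because the orbit of \<open>M v\<close> is the orbit of \<open>v\<close> with its
  first point dropped, and it belongs to \<open>I\<close> because it lies between \<open>min v\<close> and \<open>max v\<close>.\<close>

lemma invariant_mean_exists:
  fixes M :: "real ^ 'p::finite \<Rightarrow> real ^ 'p"
  assumes "is_interval I" "mean_type I M"
  shows "\<exists>K. K \<in> cube I \<rightarrow>\<^sub>E I \<and> is_mean I K \<and> invariant_on I M K"
proof -
  define K where "K = restrict (\<lambda>v. lim (\<lambda>n. vmin ((M ^^ n) v))) (cube I)"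
  have K_lim: "(\<lambda>n. vmin ((M ^^ n) v)) \<longlonglongrightarrow> K v" if v: "v \<in> cube I" for v
  proof -
    obtain a where "(\<lambda>n. vmin ((M ^^ n) v)) \<longlonglongrightarrow> a"
      using vmin_orbit_converges[OF assms(2) v] .
    then show ?thesis using v by (simp add: K_def limI)
  qed
  have lower: "vmin v \<le> K v" if "v \<in> cube I" for v
    using vmin_le_vmin_orbit[OF assms(2) that] by (intro LIMSEQ_le_const[OF K_lim[OF that]]) auto
  have upper: "K v \<le> vmax v" if "v \<in> cube I" for v
    using order_trans[OF vmin_le_vmax vmax_orbit_le_vmax[OF assms(2) that]]
    by (intro LIMSEQ_le_const2[OF K_lim[OF that]]) auto
  have in_I: "K v \<in> I" if "v \<in> cube I" for v
    using vmin_in[OF that] vmax_in[OF that] lower[OF that] upper[OF that]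
    by (rule mem_is_interval_1_I[OF assms(1)])
  have "K (M v) = K v" if "v \<in> cube I" for v
  proof -
    have "(\<lambda>n. vmin ((M ^^ Suc n) v)) \<longlonglongrightarrow> K (M v)"
      using K_lim[OF mean_type_cube[OF assms(2) that]] by (simp add: funpow_Suc_right del: funpow.simps)
    then show ?thesis
      using LIMSEQ_Suc[OF K_lim[OF that]] by (rule LIMSEQ_unique)
  qed
  moreover have "K \<in> cube I \<rightarrow>\<^sub>E I"
    using in_I by (auto simp: K_def)
  ultimately show ?thesis
    using lower upper in_I by (auto simp: is_mean_def invariant_on_def)
qed

section \<open>The invariant mean\<close>

theorem theorem2:
  fixes I :: "real set" and M :: "real ^ 'p::finite \<Rightarrow> real ^ 'p"
  assumes "is_interval I"
    and "CARD('p) > 1"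
    and "continuous_on (cube I) M"
    and "mean_type I M"
    and "weakly_contractive I M"
  shows "(\<exists>!K. K \<in> cube I \<rightarrow>\<^sub>E I \<and> is_mean I K \<and> invariant_on I M K) \<and>
         (\<forall>K. is_mean I K \<and> invariant_on I M K \<longrightarrow>
            (\<forall>v\<in>cube I. (\<lambda>n. (M ^^ n) v) \<longlonglongrightarrow> (\<chi> i. K v)))"
proof -
  note osc = oscillation_tendsto_zero[OF assms(1,3,4,5)]
  have lim: "(\<lambda>n. vmin ((M ^^ n) v)) \<longlonglongrightarrow> K v"
    if "is_mean I K" "invariant_on I M K" "v \<in> cube I" for K v
    using vmin_orbit_tendsto_invariant_mean[OF assms(4) that(3,1,2) osc[OF that(3)]] .
  have "\<exists>!K. K \<in> cube I \<rightarrow>\<^sub>E I \<and> is_mean I K \<and> invariant_on I M K"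
  proof (rule ex_ex1I)
    show "\<exists>K. K \<in> cube I \<rightarrow>\<^sub>E I \<and> is_mean I K \<and> invariant_on I M K"
      by (rule invariant_mean_exists[OF assms(1,4)])
  next
    fix K L
    assume K: "K \<in> cube I \<rightarrow>\<^sub>E I \<and> is_mean I K \<and> invariant_on I M K"
      and L: "L \<in> cube I \<rightarrow>\<^sub>E I \<and> is_mean I L \<and> invariant_on I M L"
    have "K v = L v" if "v \<in> cube I" for v
      using LIMSEQ_unique[OF lim[of K v] lim[of L v]] K L that by simp
    then show "K = L" by (rule PiE_ext[OF conjunct1[OF K] conjunct1[OF L]])
  qed
  moreover have "(\<lambda>n. (M ^^ n) v) \<longlonglongrightarrow> (\<chi> i. K v)"
    if "is_mean I K" "invariant_on I M K" "v \<in> cube I" for K v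
    using lim[OF that] osc[OF that(3)] by (rule tendsto_constant_vector)
  ultimately show ?thesis by blast
qed

end
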